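(* If $A=\{2,3\}$ or $A=\{1,4\}$, then the sequence $(\operatorname{sign}(S_{A,0}(n)))_{n\in\mathbb{N}}$ is not eventually periodic.
   Context: $\mathbb{N}$ is the set of non-negative integers and $\mathbb{N}_{+}$ the set of positive integers. For $A\subset\mathbb{N}_{+}$ and $i,n\in\mathbb{N}$, $c_{A}(i,n)$ denotes the number of $A$-compositions of $n$ with exactly $i$ parts, i.e. the number of (ordered) sequences $(\lambda_{1},\ldots,\lambda_{i})$ with all $\lambda_{j}\in A$ and $\lambda_{1}+\cdots+\lambda_{i}=n$ (so $c_A(0,0)=1$ and $c_A(0,n)=0$ for $n\ge 1$). For $n\in\mathbb{N}$ put $S_{A,0}(n)=\sum_{i=0}^{n}(-1)^{i}c_{A}(i,n)$. For real $x$, $\operatorname{sign}(x)\in\{-1,0,1\}$ is the sign of $x$, with $\operatorname{sign}(0)=0$. A sequence $(s_n)_{n\in\mathbb{N}}$ is eventually periodic if there are $d\in\mathbb{N}_{+}$ and $n_0\in\mathbb{N}$ with $s_{n+d}=s_n$ for all $n\ge n_0$. *)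

theory Defs
  imports Complex_Main
begin

text \<open>
  The definitions take an arbitrary set \<open>A\<close> of naturals, although compositions are normally
  considered only for sets of positive integers. The number of parts is fixed and each part is at
  most \<open>n\<close>, so the set below is finite for every \<open>A\<close> and taking its cardinality is harmless.
\<close>

definition compositions :: "nat set \<Rightarrow> nat \<Rightarrow> nat \<Rightarrow> nat list set" where
  "compositions A i n = {xs. length xs = i \<and> set xs \<subseteq> A \<and> sum_list xs = n}"

definition num_compositions :: "nat set \<Rightarrow> nat \<Rightarrow> nat \<Rightarrow> nat" where
  "num_compositions A i n = card (compositions A i n)"

definition alt_composition_sum :: "nat set \<Rightarrow> nat \<Rightarrow> int" where
  "alt_composition_sum A n = (\<Sum>i=0..n. (-1) ^ i * int (num_compositions A i n))"

definition eventually_periodic :: "(nat \<Rightarrow> 'a) \<Rightarrow> bool" where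
  "eventually_periodic s \<longleftrightarrow> (\<exists>d>0. \<exists>n0. \<forall>n\<ge>n0. s (n + d) = s n)"

lemma finite_compositions: "finite (compositions A i n)"
proof (rule finite_subset)
  show "compositions A i n \<subseteq> {xs. set xs \<subseteq> {..n} \<and> length xs = i}"
    by (auto simp: compositions_def member_le_sum_list)
  show "finite {xs. set xs \<subseteq> {..n} \<and> length xs = i}"
    by (rule finite_lists_length_eq) simp
qed

end

theory Submission
  imports Defs
begin

text \<open>
  The alternating sums \<open>S(n)\<close> have generating function \<open>1 / (1 + \<Sum>a\<in>A. x ^ a)\<close>, so they obey a linear
  recurrence, with characteristic polynomial \<open>t ^ 3 + t + 1\<close> for parts 2 and 3 and
  \<open>t ^ 4 + t ^ 3 + 1\<close> for parts 1 and 4. In both cases the roots of largest modulus form one pair of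
  conjugate nonreal numbers \<open>z\<close>, \<open>cnj z\<close>, whence \<open>S(n) = Re (C * z ^ n) + h n\<close> with \<open>C \<noteq> 0\<close> and \<open>h\<close>
  of smaller exponential order.

  If the signs had eventual period \<open>d\<close>, then \<open>S\<close> would have constant weak sign along some arithmetic
  progression of difference \<open>d\<close>, and hence, up to a summable error, so would \<open>Re (c * \<omega> ^ k)\<close>, where
  \<open>\<omega>\<close> is \<open>z ^ d\<close> scaled to the unit circle. When \<open>\<omega>\<close> is not real this is impossible: the sums
  \<open>\<Sum>k<n. \<omega> ^ k\<close> are bounded, so a weakly one-signed sequence of this kind is summable and tends to
  zero, whereas \<open>c * \<omega> ^ k\<close> keeps constant modulus (\<open>rotation_not_almost_nonneg\<close>,
  \<open>sgn_not_eventually_periodic\<close>).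

  It remains to see that no positive power of \<open>z\<close> is real. This is Galois theory of a cubic over the
  rationals in an elementary guise (\<open>values_at_roots_agree\<close>): let \<open>t1\<close>, \<open>t2\<close>, \<open>t3\<close> be the roots of
  an integer cubic without quadratic term, with \<open>t1\<close> irrational and \<open>t2 \<noteq> t3\<close>. If an integer polynomial
  takes the same value at \<open>t2\<close> and \<open>t3\<close>, then it takes this value at \<open>t1\<close> too. For parts 2 and 3 the
  polynomial \<open>t ^ d\<close> gives that the real root \<open>r\<close> satisfies \<open>r ^ d = z ^ d\<close>, although
  \<open>\<bar>r\<bar> < norm z\<close>. For parts 1 and 4, with \<open>y\<close>, \<open>cnj y\<close> the other two roots, the cubic is the
  resolvent \<open>t ^ 3 = 4 * t + 1\<close>, whose roots are \<open>w = z * cnj z + y * cnj y\<close>,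
  \<open>z * y + cnj z * cnj y\<close> and \<open>z * cnj y + cnj z * y\<close>; each is a sum \<open>u + 1 / u\<close>, and
  \<open>u + 1 / u \<mapsto> u ^ d + 1 / u ^ d\<close> is an integer polynomial in the sum. If \<open>z ^ d\<close> is real, its values
  at the last two roots coincide. They have absolute value at most 2, since there \<open>u\<close> lies on the
  unit circle; but at \<open>w\<close>, where \<open>u = z * cnj z > 1\<close>, the value exceeds 2.
\<close>

section \<open>A recurrence for the alternating sums\<close>

lemma compositions_Suc:
  "compositions A (Suc i) n = (\<Union>a\<in>A \<inter> {..n}. (#) a ` compositions A i (n - a))"
proof (intro set_eqI iffI)
  fix xs assume xs: "xs \<in> compositions A (Suc i) n"
  then show "xs \<in> (\<Union>a\<in>A \<inter> {..n}. (#) a ` compositions A i (n - a))"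
  proof (cases xs)
    case (Cons a ys)
    with xs have "a \<in> A \<inter> {..n}" "ys \<in> compositions A i (n - a)"
      by (auto simp: compositions_def)
    with Cons show ?thesis by blast
  qed (use xs in \<open>simp add: compositions_def\<close>)
qed (auto simp: compositions_def)

lemma num_compositions_Suc:
  assumes "finite A"
  shows "num_compositions A (Suc i) n = (\<Sum>a\<in>A \<inter> {..n}. num_compositions A i (n - a))"
  unfolding num_compositions_def compositions_Suc using assms
  by (subst card_UN_disjoint) (auto simp: finite_compositions card_image)

lemma num_compositions_eq_0:
  assumes "0 \<notin> A" "n < i"
  shows "num_compositions A i n = 0"
proof -
  have len: "length xs \<le> sum_list xs" if "set xs \<subseteq> A" for xs
    using that
  proof (induction xs)
    case (Cons a xs)
    then have "a \<in> A" by simp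
    then have "a \<noteq> 0" using assms(1) by metis
    with Cons show ?case by simp
  qed simp
  have "xs \<notin> compositions A i n" for xs
    using len[of xs] assms(2) by (auto simp: compositions_def)
  then have "compositions A i n = {}" by blast
  then show ?thesis by (simp add: num_compositions_def)
qed

lemma alt_composition_sum_0: "alt_composition_sum A 0 = 1"
proof -
  have "compositions A 0 0 = {[]}" by (auto simp: compositions_def)
  then show ?thesis by (simp add: alt_composition_sum_def num_compositions_def)
qed

text \<open>
  Splitting off the first part shortens a composition by one part and so flips the sign. The upper
  limit of the sum over the number of parts is immaterial as soon as it reaches the number composed,
  since all parts are positive.
\<close>
lemma alt_composition_sum_Suc:
  assumes "finite A" "0 \<notin> A"
  shows "alt_composition_sum A (Suc n) =
    - (\<Sum>a\<in>A \<inter> {..Suc n}. alt_composition_sum A (Suc n - a))"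
proof -
  let ?c = "\<lambda>i n. (-1) ^ i * int (num_compositions A i n)"
  have ext: "(\<Sum>i=0..n. ?c i m) = alt_composition_sum A m" if "m \<le> n" for m
    unfolding alt_composition_sum_def
    by (rule sum.mono_neutral_right) (use that assms(2) in \<open>auto simp: num_compositions_eq_0\<close>)
  have "compositions A 0 (Suc n) = {}" by (auto simp: compositions_def)
  then have "alt_composition_sum A (Suc n) = (\<Sum>i=0..n. ?c (Suc i) (Suc n))"
    unfolding alt_composition_sum_def sum.atLeast0_atMost_Suc_shift
    by (simp add: num_compositions_def)
  also have "\<dots> = - (\<Sum>i=0..n. \<Sum>a\<in>A \<inter> {..Suc n}. ?c i (Suc n - a))"
    by (simp add: num_compositions_Suc[OF assms(1)] sum_distrib_left sum_negf)
  also have "\<dots> = - (\<Sum>a\<in>A \<inter> {..Suc n}. \<Sum>i=0..n. ?c i (Suc n - a))"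
    by (subst sum.swap) simp
  also have "(\<Sum>a\<in>A \<inter> {..Suc n}. \<Sum>i=0..n. ?c i (Suc n - a)) =
      (\<Sum>a\<in>A \<inter> {..Suc n}. alt_composition_sum A (Suc n - a))"
  proof (intro sum.cong refl ext)
    fix a assume "a \<in> A \<inter> {..Suc n}"
    then have "a \<noteq> 0" using assms(2) by (metis IntD1)
    then show "Suc n - a \<le> n" by simp
  qed
  finally show ?thesis .
qed

lemma alt_composition_sum_2_3:
  defines "f \<equiv> alt_composition_sum {2, 3}"
  shows "f 0 = 1" "f 1 = 0" "f 2 = -1" "f (n + 3) = - f (n + 1) - f n"
proof -
  have s: "f m = - (\<Sum>a\<in>{2, 3} \<inter> {..m}. f (m - a))" if pos: "0 < m" for m
  proof -
    obtain k where m: "m = Suc k" using gr0_implies_Suc[OF pos] by blast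
    show ?thesis unfolding f_def m by (rule alt_composition_sum_Suc) auto
  qed
  show 0: "f 0 = 1" by (simp add: f_def alt_composition_sum_0)
  have "{2, 3} \<inter> {..1} = ({} :: nat set)" by auto
  then show "f 1 = 0" using s[of 1] by simp
  have "{2, 3} \<inter> {..2} = {2 :: nat}" by auto
  then show "f 2 = -1" using s[of 2] 0 by simp
  have parts: "{2, 3} \<inter> {..n + 3} = {2, 3}" by auto
  have "f (n + 3) = - (\<Sum>a\<in>{2, 3} \<inter> {..n + 3}. f (n + 3 - a))" by (rule s) simp
  also have "\<dots> = - (f (n + 3 - 2) + f (n + 3 - 3))" unfolding parts by simp
  also have "n + 3 - 2 = n + 1" by simp
  finally show "f (n + 3) = - f (n + 1) - f n" by simp
qed

lemma alt_composition_sum_1_4: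
  defines "f \<equiv> alt_composition_sum {1, 4}"
  shows "f 0 = 1" "f 1 = -1" "f 2 = 1" "f (n + 4) = - f (n + 3) - f n"
proof -
  have s: "f m = - (\<Sum>a\<in>{1, 4} \<inter> {..m}. f (m - a))" if pos: "0 < m" for m
  proof -
    obtain k where m: "m = Suc k" using gr0_implies_Suc[OF pos] by blast
    show ?thesis unfolding f_def m by (rule alt_composition_sum_Suc) auto
  qed
  show 0: "f 0 = 1" by (simp add: f_def alt_composition_sum_0)
  have "{1, 4} \<inter> {..1} = {1 :: nat}" by auto
  then show 1: "f 1 = -1" using s[of 1] 0 by simp
  have "{1, 4} \<inter> {..2} = {1 :: nat}" by auto
  then show "f 2 = 1" using s[of 2] 1 by simp
  have parts: "{1, 4} \<inter> {..n + 4} = {1, 4}" by auto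
  have "f (n + 4) = - (\<Sum>a\<in>{1, 4} \<inter> {..n + 4}. f (n + 4 - a))" by (rule s) simp
  also have "\<dots> = - (f (n + 4 - 1) + f (n + 4 - 4))" unfolding parts by simp
  also have "n + 4 - 1 = n + 3" by simp
  finally show "f (n + 4) = - f (n + 3) - f n" by simp
qed

section \<open>Sign changes of sequences dominated by a rotation\<close>

text \<open>
  Otherwise \<open>Re (c * \<omega> ^ k) + \<epsilon> k\<close> has nonnegative terms and bounded partial sums, so the real parts
  tend to zero. As \<open>\<omega>\<close> is not real, the imaginary part of \<open>c * \<omega> ^ k\<close> is a combination of two
  successive real parts, so all of \<open>c * \<omega> ^ k\<close> tends to zero, against its constant modulus.
\<close>
lemma rotation_not_almost_nonneg:
  fixes c \<omega> :: complex and \<epsilon> :: "nat \<Rightarrow> real"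
  assumes "c \<noteq> 0" "norm \<omega> = 1" "\<omega> \<notin> \<real>" "summable \<epsilon>"
  shows "\<exists>k. Re (c * \<omega> ^ k) < - \<epsilon> k"
proof (rule ccontr)
  assume "\<not> ?thesis"
  then have pos: "0 \<le> Re (c * \<omega> ^ k) + \<epsilon> k" for k by (smt (verit))
  have "\<omega> \<noteq> 1" using assms(3) by auto
  obtain B where B: "\<And>n. norm (\<Sum>k<n. \<epsilon> k) \<le> B"
    using assms(4)[unfolded summable_iff_convergent] convergent_imp_Bseq BseqD by blast
  have "(\<Sum>k<n. Re (c * \<omega> ^ k) + \<epsilon> k) \<le> norm c * (2 / norm (\<omega> - 1)) + B" for n
  proof -
    have "(\<Sum>k<n. Re (c * \<omega> ^ k)) = Re (c * ((\<omega> ^ n - 1) / (\<omega> - 1)))"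
      by (simp only: geometric_sum[OF \<open>\<omega> \<noteq> 1\<close>, symmetric] sum_distrib_left Re_sum)
    also have "\<dots> \<le> norm (c * ((\<omega> ^ n - 1) / (\<omega> - 1)))" by (rule complex_Re_le_cmod)
    also have "\<dots> = norm c * (norm (\<omega> ^ n - 1) / norm (\<omega> - 1))"
      by (simp add: norm_mult norm_divide)
    also have "\<dots> \<le> norm c * (2 / norm (\<omega> - 1))"
      using norm_triangle_ineq4[of "\<omega> ^ n" 1] assms(2)
      by (intro mult_left_mono divide_right_mono) (auto simp: norm_power)
    finally show ?thesis using B[of n] by (simp add: sum.distrib)
  qed
  then have "summable (\<lambda>k. Re (c * \<omega> ^ k) + \<epsilon> k)"
    by (intro summableI_nonneg_bounded pos)
  then have "summable (\<lambda>k. Re (c * \<omega> ^ k))"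
    using summable_diff[OF _ assms(4)] by fastforce
  then have re: "(\<lambda>k. Re (c * \<omega> ^ k)) \<longlonglongrightarrow> 0" by (rule summable_LIMSEQ_zero)
  have "Im \<omega> \<noteq> 0" using assms(3) by (simp add: complex_is_Real_iff)
  then have "Im (c * \<omega> ^ k) = (Re \<omega> * Re (c * \<omega> ^ k) - Re (c * \<omega> ^ Suc k)) / Im \<omega>" for k
    by (simp add: field_simps)
  moreover have "(\<lambda>k. (Re \<omega> * Re (c * \<omega> ^ k) - Re (c * \<omega> ^ Suc k)) / Im \<omega>) \<longlonglongrightarrow>
      (Re \<omega> * 0 - 0) / Im \<omega>"
    using \<open>Im \<omega> \<noteq> 0\<close> by (intro tendsto_intros re LIMSEQ_Suc[OF re])
  ultimately have "(\<lambda>k. Im (c * \<omega> ^ k)) \<longlonglongrightarrow> 0" by simp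
  with re have "(\<lambda>k. c * \<omega> ^ k) \<longlonglongrightarrow> 0"
    by (subst tendsto_complex_iff) simp
  then have "(\<lambda>k. norm (c * \<omega> ^ k)) \<longlonglongrightarrow> 0" by (rule tendsto_norm_zero)
  then show False using assms(1,2) by (simp add: norm_mult norm_power LIMSEQ_const_iff)
qed

text \<open>
  Along an arithmetic progression whose difference is a period, \<open>f\<close> keeps its sign; dividing by the
  growth rate \<open>norm z ^ n\<close> turns the main term into a rotation by the direction of \<open>z ^ d\<close> and the
  remainder into a geometric sequence with ratio below 1.
\<close>
lemma sgn_not_eventually_periodic:
  fixes f :: "nat \<Rightarrow> int" and C z :: complex
  assumes f: "\<And>n. real_of_int (f n) = Re (C * z ^ n) + h n"
    and h: "\<And>n. \<bar>h n\<bar> \<le> K * q ^ n" and q: "0 \<le> q" "q < norm z"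
    and C: "C \<noteq> 0" and z: "\<And>d. 0 < d \<Longrightarrow> z ^ d \<notin> \<real>"
  shows "\<not> eventually_periodic (\<lambda>n. sgn (f n))"
proof
  assume "eventually_periodic (\<lambda>n. sgn (f n))"
  then obtain d n0 where d: "0 < d" and per: "\<And>n. n0 \<le> n \<Longrightarrow> sgn (f (n + d)) = sgn (f n)"
    by (auto simp: eventually_periodic_def)
  have const: "sgn (f (n0 + k * d)) = sgn (f n0)" for k
    by (induction k) (use per[of "n0 + _ * d"] in \<open>simp_all add: algebra_simps\<close>)
  \<comment> \<open>A constant sign 0 may be counted as nonnegative, so two values of \<open>\<sigma>\<close> suffice.\<close>
  define \<sigma> :: real where "\<sigma> = (if f n0 < 0 then -1 else 1)"
  have \<sigma>: "0 \<le> \<sigma> * f (n0 + k * d)" "\<bar>\<sigma>\<bar> = 1" for k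
    using const[of k] by (auto simp: \<sigma>_def sgn_if split: if_splits)
  define R where "R = norm z"
  have R: "0 < R" "q < R" using q by (auto simp: R_def)
  define \<omega> where "\<omega> = (z / R) ^ d"
  define c where "c = \<sigma> * C * (z / R) ^ n0"
  have z0: "z \<noteq> 0" using R by (auto simp: R_def)
  have "c \<noteq> 0" using C z0 R \<sigma>(2) by (auto simp: c_def)
  moreover have "norm \<omega> = 1" using R by (simp add: \<omega>_def norm_power norm_divide R_def)
  moreover have "\<omega> \<notin> \<real>"
  proof
    assume "\<omega> \<in> \<real>"
    then have "\<omega> * of_real (R ^ d) \<in> \<real>" by (intro Reals_mult) auto
    also have "\<omega> * of_real (R ^ d) = z ^ d" using R by (simp add: \<omega>_def power_divide)
    finally show False using z d by blast
  qed
  moreover define \<epsilon> where "\<epsilon> k = K * (q / R) ^ n0 * ((q / R) ^ d) ^ k" for k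
  have "norm ((q / R) ^ d) < 1" using R q d by (simp add: power_less_one_iff)
  then have "summable \<epsilon>" unfolding \<epsilon>_def by (intro summable_mult summable_geometric)
  ultimately obtain k where k: "Re (c * \<omega> ^ k) < - \<epsilon> k"
    using rotation_not_almost_nonneg by blast
  define n where "n = n0 + k * d"
  have "c * \<omega> ^ k = \<sigma> * (C * z ^ n) / of_real (R ^ n)"
    by (simp add: c_def \<omega>_def n_def power_add power_mult power_divide mult.commute)
  then have "Re (c * \<omega> ^ k) = \<sigma> * Re (C * z ^ n) / R ^ n"
    by (simp only: Re_divide_of_real Re_complex_of_real Im_complex_of_real times_complex.sel) simp
  moreover have "\<epsilon> k = K * q ^ n / R ^ n"
    by (simp add: \<epsilon>_def n_def power_add power_mult power_divide mult.commute)
  ultimately have "(\<sigma> * Re (C * z ^ n) + K * q ^ n) / R ^ n < 0"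
    using k by (simp only: add_divide_distrib)
  then have "\<sigma> * Re (C * z ^ n) < - (K * q ^ n)"
    using R by (simp add: divide_less_0_iff zero_less_power[THEN less_not_sym] del: times_complex.sel)
  moreover have "\<sigma> * h n \<le> K * q ^ n"
    using h[of n] \<sigma>(2) by (metis abs_mult abs_ge_self mult_1 order_trans)
  moreover have "0 \<le> \<sigma> * Re (C * z ^ n) + \<sigma> * h n"
    using \<sigma>(1)[of k] by (simp add: f n_def distrib_left)
  ultimately show False by linarith
qed

text \<open>
  The initial values \<open>v 0 = Re D\<close> and \<open>v 1 = Re (D * z)\<close> can be prescribed because \<open>z\<close> is not real.
\<close>
lemma second_order_recurrence_solution:
  fixes v :: "nat \<Rightarrow> real" and z :: complex
  assumes v: "\<And>n. v (n + 2) = p * v (n + 1) - m * v n"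
    and z: "z ^ 2 = p * z - m" "Im z \<noteq> 0"
  shows "\<exists>D. \<forall>n. v n = Re (D * z ^ n)"
proof -
  define D where "D = Complex (v 0) ((Re z * v 0 - v 1) / Im z)"
  have "v n = Re (D * z ^ n) \<and> v (Suc n) = Re (D * z ^ Suc n)" for n
  proof (induction n)
    case 0
    show ?case using z(2) by (simp add: D_def)
  next
    case (Suc n)
    have "D * z ^ Suc (Suc n) = D * z ^ n * z ^ 2" by (simp add: power2_eq_square)
    also have "\<dots> = of_real p * (D * z ^ Suc n) - of_real m * (D * z ^ n)"
      by (simp add: z(1) algebra_simps)
    finally have "Re (D * z ^ Suc (Suc n)) = p * Re (D * z ^ Suc n) - m * Re (D * z ^ n)"
      by (simp only: minus_complex.sel Re_complex_of_real Im_complex_of_real times_complex.sel)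
    then show ?case using Suc v[of n] by simp
  qed
  then show ?thesis by blast
qed

lemma nonreal_quadratic_root:
  fixes a b :: real
  assumes "a ^ 2 < 4 * b"
  shows "\<exists>z. z + cnj z = - a \<and> z * cnj z = b \<and> Im z \<noteq> 0 \<and> norm z = sqrt b \<and>
    z ^ 2 = of_real (- a) * z - of_real b"
proof -
  define z where "z = Complex (- a / 2) (sqrt (b - a ^ 2 / 4))"
  have s: "z + cnj z = - a" "z * cnj z = b"
    using assms by (auto simp: z_def complex_eq_iff power2_eq_square field_simps)
  have "z ^ 2 = (z + cnj z) * z - z * cnj z" by (simp add: algebra_simps power2_eq_square)
  then have "z ^ 2 = of_real (- a) * z - of_real b" unfolding s by simp
  moreover have "norm z = sqrt b"
    using assms by (simp add: z_def cmod_def power_divide)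
  ultimately show ?thesis using s assms by (intro exI[of _ z]) (auto simp: z_def)
qed

section \<open>Integer polynomials at the roots of a cubic\<close>

text \<open>
  Only the values at the roots of \<open>t ^ 3 = m * t + k\<close> matter, so \<open>f\<close> stands for an element of the ring
  of integer polynomials modulo this cubic, and \<open>p\<close>, \<open>q\<close>, \<open>r\<close> are the coefficients of its remainder.
  One remainder must serve all three roots: this is what ties the conjugates together.
\<close>
definition int_quadratic_on_roots :: "int \<Rightarrow> int \<Rightarrow> (complex \<Rightarrow> complex) \<Rightarrow> bool" where
  "int_quadratic_on_roots m k f \<longleftrightarrow> (\<exists>p q r :: int. \<forall>x. x ^ 3 = of_int m * x + of_int k \<longrightarrow>
     f x = of_int p + of_int q * x + of_int r * x ^ 2)"

lemma int_quadratic_on_roots_const: "int_quadratic_on_roots m k (\<lambda>x. of_int a)"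
  unfolding int_quadratic_on_roots_def
  by (rule exI[of _ a], rule exI[of _ 0], rule exI[of _ 0]) simp

lemma int_quadratic_on_roots_diff:
  assumes "int_quadratic_on_roots m k f" "int_quadratic_on_roots m k g"
  shows "int_quadratic_on_roots m k (\<lambda>x. f x - g x)"
proof -
  obtain p q r p' q' r' where
    "\<And>x. x ^ 3 = of_int m * x + of_int k \<Longrightarrow> f x = of_int p + of_int q * x + of_int r * x ^ 2"
    "\<And>x. x ^ 3 = of_int m * x + of_int k \<Longrightarrow> g x = of_int p' + of_int q' * x + of_int r' * x ^ 2"
    using assms unfolding int_quadratic_on_roots_def by blast
  then show ?thesis
    unfolding int_quadratic_on_roots_def
    by (intro exI[of _ "p - p'"] exI[of _ "q - q'"] exI[of _ "r - r'"]) (auto simp: algebra_simps)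
qed

lemma int_quadratic_on_roots_mult_var:
  assumes "int_quadratic_on_roots m k f"
  shows "int_quadratic_on_roots m k (\<lambda>x. x * f x)"
proof -
  obtain p q r where
    f: "\<And>x. x ^ 3 = of_int m * x + of_int k \<Longrightarrow> f x = of_int p + of_int q * x + of_int r * x ^ 2"
    using assms unfolding int_quadratic_on_roots_def by blast
  have "x * f x = of_int (r * k) + of_int (p + r * m) * x + of_int q * x ^ 2"
    if x: "x ^ 3 = of_int m * x + of_int k" for x
  proof -
    have "x * f x = of_int p * x + of_int q * x ^ 2 + of_int r * x ^ 3"
      using f[OF x] by (simp add: algebra_simps power2_eq_square power3_eq_cube)
    then show ?thesis by (simp add: x algebra_simps)
  qed
  then show ?thesis unfolding int_quadratic_on_roots_def by blast
qed

text \<open>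
  A rational root would be an integer dividing \<open>k\<close>, hence \<open>1\<close> or \<open>-1\<close>.
\<close>
lemma cubic_root_irrational:
  fixes x :: complex
  assumes x: "x ^ 3 = of_int m * x + of_int k" and k: "\<bar>k\<bar> = 1"
    and m: "m + k \<noteq> 1" "m - k \<noteq> 1"
  shows "x \<notin> \<rat>"
proof
  assume "x \<in> \<rat>"
  then obtain r where r: "x = of_rat r" by (rule Rats_cases)
  obtain a b where ab: "r = Fract a b" "b > 0" "coprime a b" by (cases r)
  have "x = of_int a / of_int b" using ab by (simp add: r of_rat_rat)
  then have xb: "of_int a = x * of_int b" using ab(2) by simp
  have "(of_int a :: complex) ^ 3 = of_int b ^ 2 * (of_int m * of_int a + of_int k * of_int b)"
    unfolding xb power_mult_distrib x by (simp add: algebra_simps power2_eq_square power3_eq_cube)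
  then have "(of_int (a ^ 3) :: complex) = of_int (b ^ 2 * (m * a + k * b))" by simp
  then have eq: "a ^ 3 = b ^ 2 * (m * a + k * b)" by (simp only: of_int_eq_iff)
  then have "b dvd a ^ 3" by (simp add: power2_eq_square mult.assoc)
  then have "b dvd 1" using ab(3)
    by (metis coprime_commute coprime_power_right_iff coprime_absorb_left)
  then have "b = 1" using ab(2) by simp
  then have a: "a ^ 3 = m * a + k" using eq by simp
  then have "k = a * (a ^ 2 - m)" by (simp add: algebra_simps power2_eq_square power3_eq_cube)
  then have "a dvd k" by simp
  then have "\<bar>a\<bar> = 1" using k by (metis dvd_abs_iff zdvd1_eq)
  then have "a = 1 \<or> a = -1" by linarith
  then show False using a m by auto
qed

text \<open>
  Cancelling \<open>y - z\<close> from \<open>f y = f z\<close> leaves \<open>q + r * (y + z) = 0\<close>, that is \<open>q = r * x\<close>. Irrationality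
  of \<open>x\<close> makes the remainder of \<open>f\<close> constant.
\<close>
lemma values_at_roots_agree:
  fixes x y z :: complex
  assumes roots: "x ^ 3 = of_int m * x + of_int k" "y ^ 3 = of_int m * y + of_int k"
      "z ^ 3 = of_int m * z + of_int k"
    and sum: "x + y + z = 0" and "y \<noteq> z" and irr: "x \<notin> \<rat>"
    and f: "int_quadratic_on_roots m k f" and eq: "f y = f z"
  shows "f x = f y"
proof -
  obtain p q r where
    f: "\<And>x. x ^ 3 = of_int m * x + of_int k \<Longrightarrow> f x = of_int p + of_int q * x + of_int r * x ^ 2"
    using f unfolding int_quadratic_on_roots_def by blast
  have "(y - z) * (of_int q + of_int r * (y + z)) = 0"
    using eq f[OF roots(2)] f[OF roots(3)] by (simp add: algebra_simps power2_eq_square)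
  then have "of_int q + of_int r * (y + z) = 0" using \<open>y \<noteq> z\<close> by simp
  moreover have "y + z = - x" using sum by (simp add: algebra_simps add_eq_0_iff)
  ultimately have qr: "of_int q = of_int r * x" by simp
  have "r = 0"
  proof (rule ccontr)
    assume "r \<noteq> 0"
    then have "x = of_int q / of_int r" using qr by simp
    then show False using irr by simp
  qed
  with qr have "q = 0" by simp
  then show ?thesis using \<open>r = 0\<close> f roots by simp
qed

section \<open>Parts 2 and 3\<close>

text \<open>
  The cubic factors as \<open>t ^ 3 + t + 1 = (t - r) * (t ^ 2 + r * t + 1 + r ^ 2)\<close> with \<open>-1 < r < 0\<close>, so
  that the nonreal roots have modulus above 1.
\<close>
lemma not_eventually_periodic_2_3: "\<not> eventually_periodic (\<lambda>n. sgn (alt_composition_sum {2, 3} n))"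
proof -
  define f where "f = alt_composition_sum {2, 3}"
  note rec = alt_composition_sum_2_3[folded f_def]
  have "\<exists>r\<ge>-1. r \<le> 0 \<and> r ^ 3 + r + 1 = (0 :: real)"
    by (rule IVT) (auto intro!: continuous_intros)
  then obtain r :: real where r01: "-1 \<le> r" "r \<le> 0" and r: "r ^ 3 + r + 1 = 0" by blast
  have r0: "r \<noteq> 0" "r \<noteq> -1" using r by auto
  have "r ^ 2 < 4 * (1 + r ^ 2)" by (simp add: distrib_left add_nonneg_pos)
  then obtain z where zz: "z + cnj z = - r" "z * cnj z = 1 + r ^ 2" and im: "Im z \<noteq> 0"
      and norm_z: "norm z = sqrt (1 + r ^ 2)" and z2: "z ^ 2 = of_real (- r) * z - of_real (1 + r ^ 2)"
    using nonreal_quadratic_root by blast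
  \<comment> \<open>This combination of shifts removes the contribution of the root \<open>r\<close>.\<close>
  define v where "v n = f (n + 1) - r * f n" for n
  have r3: "r ^ 3 = - r - 1" using r by simp
  have v: "v (n + 2) = - r * v (n + 1) - (1 + r ^ 2) * v n" for n
  proof -
    have shift: "n + 2 + 1 = n + 3" "n + 1 + 1 = n + 2" by simp_all
    have f3: "real_of_int (f (n + 3)) = - f (n + 1) - f n" using rec(4)[of n] by simp
    have "v (n + 2) + r * v (n + 1) + (1 + r ^ 2) * v n
        = f (n + 3) + f (n + 1) - (r ^ 3 + r) * f n"
      unfolding v_def shift by (simp add: algebra_simps power2_eq_square power3_eq_cube)
    also have "\<dots> = 0" by (simp only: r3 f3 of_int_add) simp
    finally show ?thesis by (simp add: algebra_simps)
  qed
  obtain D where D: "\<And>n. v n = Re (D * z ^ n)"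
    using second_order_recurrence_solution[OF v z2] im by auto
  have "D \<noteq> 0" using D[of 0] rec r0 by (auto simp: v_def)
  have zr: "z - r \<noteq> 0" using im by (auto simp: complex_eq_iff)
  \<comment> \<open>On \<open>z ^ n\<close> the same combination acts as multiplication by \<open>z - r\<close>.\<close>
  define C where "C = D / (z - r)"
  have "C \<noteq> 0" using zr \<open>D \<noteq> 0\<close> by (simp add: C_def)
  define h where "h n = f n - Re (C * z ^ n)" for n
  have "h (Suc n) = r * h n" for n
  proof -
    have "D * z ^ n = C * z ^ Suc n - r * (C * z ^ n)"
    proof -
      have "D * z ^ n = C * (z - r) * z ^ n" using zr by (simp add: C_def)
      then show ?thesis by (simp add: algebra_simps)
    qed
    then have "v n = Re (C * z ^ Suc n) - r * Re (C * z ^ n)"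
      unfolding D by simp
    then show ?thesis by (simp add: h_def v_def algebra_simps)
  qed
  then have hn: "h n = h 0 * r ^ n" for n by (induction n) auto
  have nz: "norm z > 1" using r0 by (simp add: norm_z)
  have rr: "complex_of_real r ^ 3 = of_int (-1) * of_real r + of_int (-1)"
    using arg_cong[OF r3, of complex_of_real] by simp
  have z3: "z ^ 3 = of_int (-1) * z + of_int (-1)"
  proof -
    have "z ^ 3 = (of_real r) ^ 3 + (z - r) * (z ^ 2 + r * z + r ^ 2)"
      by (simp add: algebra_simps power2_eq_square power3_eq_cube)
    also have "z ^ 2 + r * z + r ^ 2 = -1" by (simp add: z2)
    finally show ?thesis by (simp add: rr)
  qed
  have nonreal: "z ^ d \<notin> \<real>" if "0 < d" for d
  proof
    assume "z ^ d \<in> \<real>"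
    then have "z ^ d = cnj z ^ d" by (simp add: Reals_cnj_iff)
    moreover have "int_quadratic_on_roots (-1) (-1) (\<lambda>x. x ^ d)"
    proof (induction d)
      case 0
      show ?case using int_quadratic_on_roots_const[of _ _ 1] by simp
    qed (simp add: int_quadratic_on_roots_mult_var)
    moreover have "cnj z ^ 3 = of_int (-1) * cnj z + of_int (-1)"
      using arg_cong[OF z3, of cnj] by simp
    moreover have "of_real r + z + cnj z = 0" using zz(1) by (simp add: add.assoc)
    moreover have "z \<noteq> cnj z" using im by (simp add: complex_eq_iff)
    ultimately have "(of_real r) ^ d = z ^ d"
      by (intro values_at_roots_agree[of _ "-1" "-1" z "cnj z"] rr z3 cubic_root_irrational[OF rr]) auto
    then have "\<bar>r\<bar> ^ d = norm z ^ d"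
      by (metis norm_of_real norm_power)
    then have "\<bar>r\<bar> = norm z" using that by (simp add: power_eq_iff_eq_base)
    then show False using nz r01 by simp
  qed
  have "\<not> eventually_periodic (\<lambda>n. sgn (f n))"
  proof (rule sgn_not_eventually_periodic)
    show "real_of_int (f n) = Re (C * z ^ n) + h n" for n by (simp add: h_def)
    show "\<bar>h n\<bar> \<le> \<bar>h 0\<bar> * \<bar>r\<bar> ^ n" for n by (subst hn) (simp add: abs_mult power_abs)
    show "0 \<le> \<bar>r\<bar>" "\<bar>r\<bar> < norm z" using nz r01 by auto
  qed (fact \<open>C \<noteq> 0\<close>, fact nonreal)
  then show ?thesis by (simp add: f_def)
qed

section \<open>Parts 1 and 4\<close>

text \<open>
  The polynomials expressing \<open>u ^ n + 1 / u ^ n\<close> through \<open>u + 1 / u\<close>: twice the Chebyshev polynomials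
  of the first kind at \<open>x / 2\<close>. The recursion shows that their coefficients are integers.
\<close>
fun lucas :: "nat \<Rightarrow> complex \<Rightarrow> complex" where
  "lucas 0 x = 2"
| "lucas (Suc 0) x = x"
| "lucas (Suc (Suc n)) x = x * lucas (Suc n) x - lucas n x"

lemma lucas_eq:
  assumes "u * v = 1"
  shows "lucas n (u + v) = u ^ n + v ^ n"
proof (induction n rule: lucas.induct[of "\<lambda>n _. lucas n (u + v) = u ^ n + v ^ n", OF _ _ _])
  fix n
  assume "lucas (Suc n) (u + v) = u ^ Suc n + v ^ Suc n" "lucas n (u + v) = u ^ n + v ^ n"
  then have "lucas (Suc (Suc n)) (u + v) =
      (u + v) * (u ^ Suc n + v ^ Suc n) - (u * v) * (u ^ n + v ^ n)"
    by (simp add: assms)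
  also have "\<dots> = u ^ Suc (Suc n) + v ^ Suc (Suc n)" by (simp add: algebra_simps)
  finally show "lucas (Suc (Suc n)) (u + v) = u ^ Suc (Suc n) + v ^ Suc (Suc n)" .
qed simp_all

lemma int_quadratic_on_roots_lucas: "int_quadratic_on_roots m k (lucas n)"
proof (induction n rule: induct_nat_012)
  case 0
  show ?case using int_quadratic_on_roots_const[of m k 2] by simp
next
  case 1
  show ?case
    using int_quadratic_on_roots_mult_var[OF int_quadratic_on_roots_const[of m k 1]] by (simp add: fun_eq_iff)
next
  case (ge2 n)
  then show ?case
    using int_quadratic_on_roots_diff[OF int_quadratic_on_roots_mult_var] by simp
qed

text \<open>
  The equations between the coefficients say that \<open>t ^ 4 + t ^ 3 + 1\<close> is the product of
  \<open>t ^ 2 + a * t + b\<close> and \<open>t ^ 2 + c * t + e\<close>. The numbers \<open>w\<close>, \<open>w1\<close>, \<open>w2\<close> below are the roots of its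
  cubic resolvent \<open>t ^ 3 - 4 * t - 1\<close>, one for each way of splitting the four roots into two pairs.
  Conjugating \<open>z\<close> alone exchanges \<open>w1\<close> and \<open>w2\<close>, and a real \<open>z ^ d\<close> does not notice this exchange.
\<close>
lemma quartic_root_power_not_real:
  fixes z y :: complex and a b c e :: real
  assumes zz: "z + cnj z = - a" "z * cnj z = b" and yy: "y + cnj y = - c" "y * cnj y = e"
    and im: "Im z \<noteq> 0" "Im y \<noteq> 0" and b: "1 < b"
    and co: "a + c = 1" "b + e + a * c = 0" "a * e + b * c = 0" "b * e = 1"
    and d: "0 < d"
  shows "z ^ d \<notin> \<real>"
proof
  assume "z ^ d \<in> \<real>"
  then have zd: "cnj z ^ d = z ^ d" by (simp add: Reals_cnj_iff)
  define w where "w = b + e"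
  define w1 w2 where "w1 = z * y + cnj z * cnj y" and "w2 = z * cnj y + cnj z * y"
  have a_eq: "a = - (b ^ 2) * c"
  proof -
    have "b * (a * e + b * c) = 0" using co by simp
    then have "a * (b * e) + b ^ 2 * c = 0" by (simp add: algebra_simps power2_eq_square)
    then show ?thesis using co by simp
  qed
  have w: "w = b ^ 2 * c ^ 2" using co(2) a_eq by (simp add: w_def power2_eq_square)
  have w3: "w ^ 3 = 4 * w + 1"
  proof -
    have "b ^ 2 * (w * (w ^ 2 - 4)) = w * (b * w - 2 * b) * (b * w + 2 * b)"
      by (simp add: algebra_simps power2_eq_square)
    also have "b * w = b ^ 2 + 1" using co(4) by (simp add: w_def algebra_simps power2_eq_square)
    also have "w * (b ^ 2 + 1 - 2 * b) * (b ^ 2 + 1 + 2 * b) = b ^ 2 * ((1 - b ^ 2) * c) ^ 2"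
      unfolding w by (simp add: algebra_simps power2_eq_square)
    also have "(1 - b ^ 2) * c = 1" using co(1) a_eq by (simp add: algebra_simps)
    finally have "w * (w ^ 2 - 4) = 1" using b by simp
    then show ?thesis by (simp add: algebra_simps power2_eq_square power3_eq_cube)
  qed
  have sum: "w1 + w2 = - of_real w"
  proof -
    have "w1 + w2 = (z + cnj z) * (y + cnj y)" by (simp add: w1_def w2_def algebra_simps)
    also have "\<dots> = of_real (a * c)" by (simp add: zz yy)
    also have "a * c = - w" using co(2) by (simp add: w_def)
    finally show ?thesis by simp
  qed
  have prod: "w1 * w2 = of_real (w ^ 2 - 4)"
  proof -
    have "w1 * w2 = (y * cnj y) * ((z + cnj z) ^ 2 - 2 * (z * cnj z))
        + (z * cnj z) * ((y + cnj y) ^ 2 - 2 * (y * cnj y))"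
      by (simp add: w1_def w2_def algebra_simps power2_eq_square)
    also have "\<dots> = of_real (e * (a ^ 2 - 2 * b) + b * (c ^ 2 - 2 * e))" by (simp add: zz yy)
    also have "e * (a ^ 2 - 2 * b) + b * (c ^ 2 - 2 * e) = w ^ 2 - 4"
    proof -
      have "e * a ^ 2 = b * e * (b * b ^ 2 * c ^ 2)" by (simp add: a_eq power2_eq_square)
      then have "e * (a ^ 2 - 2 * b) + b * (c ^ 2 - 2 * e) = b * (b ^ 2 * c ^ 2) + b * c ^ 2 - 4 * (b * e)"
        using co(4) by (simp add: algebra_simps)
      also have "b * c ^ 2 = (b * e) * (b * c ^ 2)" by (simp add: co(4))
      also have "b * (b ^ 2 * c ^ 2) + (b * e) * (b * c ^ 2) - 4 * (b * e) = (b + e) * (b ^ 2 * c ^ 2) - 4 * (b * e)"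
        by (simp add: algebra_simps power2_eq_square)
      also have "\<dots> = w ^ 2 - 4" by (simp only: co(4) w[symmetric] w_def[symmetric]) (simp add: power2_eq_square)
      finally show ?thesis .
    qed
    finally show ?thesis .
  qed
  \<comment> \<open>Dividing the resolvent by \<open>t - w\<close> leaves \<open>t ^ 2 + w * t + w ^ 2 - 4\<close>, whose roots \<open>sum\<close> and
      \<open>prod\<close> identify as \<open>w1\<close> and \<open>w2\<close>.\<close>
  have root: "t ^ 3 = of_int 4 * t + of_int 1"
    if "t + t' = - of_real w" "t * t' = of_real (w ^ 2 - 4)" for t t' :: complex
  proof -
    have t': "t' = - of_real w - t" using that(1) by (simp add: algebra_simps eq_neg_iff_add_eq_0)
    have "t ^ 2 + t * w + w ^ 2 - 4 = 0"
      using that(2) by (simp add: t' algebra_simps power2_eq_square)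
    moreover have "t ^ 3 = (t - w) * (t ^ 2 + t * w + w ^ 2 - 4) + (of_real (w ^ 3) - 4 * w) + 4 * t"
      by (simp add: algebra_simps power2_eq_square power3_eq_cube)
    moreover have "complex_of_real (w ^ 3) - 4 * w = 1" by (simp only: w3) simp
    ultimately show ?thesis by simp
  qed
  have roots: "w1 ^ 3 = of_int 4 * w1 + of_int 1" "w2 ^ 3 = of_int 4 * w2 + of_int 1"
    using root[of w1 w2] root[of w2 w1] sum prod by (auto simp: add.commute mult.commute)
  have rw: "complex_of_real w ^ 3 = of_int 4 * of_real w + of_int 1"
    using w3 by (simp flip: of_real_power)
  have "w1 - w2 = (z - cnj z) * (y - cnj y)" by (simp add: w1_def w2_def algebra_simps)
  then have "w1 \<noteq> w2" using im by (auto simp: complex_eq_iff)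
  have be: "of_real b * of_real e = (1 :: complex)" using co(4) by (simp flip: of_real_mult)
  have u: "(z * y) * (cnj z * cnj y) = 1" "(z * cnj y) * (cnj z * y) = 1"
    using be by (simp_all flip: zz yy add: mult_ac)
  have l1: "lucas d w1 = (z * y) ^ d + (cnj z * cnj y) ^ d" unfolding w1_def by (rule lucas_eq[OF u(1)])
  have "lucas d w2 = (z * cnj y) ^ d + (cnj z * y) ^ d" unfolding w2_def by (rule lucas_eq[OF u(2)])
  then have "lucas d w1 = lucas d w2" unfolding l1 by (simp add: power_mult_distrib zd)
  then have "lucas d (of_real w) = lucas d w1"
    using sum \<open>w1 \<noteq> w2\<close>
    by (intro values_at_roots_agree[OF rw roots] cubic_root_irrational[OF rw]
        int_quadratic_on_roots_lucas) (auto simp: add.assoc)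
  moreover have "lucas d (of_real w) = of_real b ^ d + of_real e ^ d"
    unfolding w_def of_real_add by (rule lucas_eq[OF be])
  ultimately have "complex_of_real (b ^ d + e ^ d) = (z * y) ^ d + (cnj z * cnj y) ^ d" using l1 by simp
  then have "\<bar>b ^ d + e ^ d\<bar> = norm ((z * y) ^ d + (cnj z * cnj y) ^ d)" by (metis norm_of_real)
  also have "\<dots> \<le> norm ((z * y) ^ d) + norm ((cnj z * cnj y) ^ d)" by (rule norm_triangle_ineq)
  also have "\<dots> = 2"
  proof -
    have "norm (z * y) ^ 2 = 1"
      using arg_cong[OF u(1), of norm] by (simp add: norm_mult power2_eq_square)
    then have "norm (z * y) = 1" by (simp add: power2_eq_1_iff) (smt (verit) norm_ge_zero)
    then show ?thesis by (simp add: norm_power norm_mult)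
  qed
  finally have le: "b ^ d + e ^ d \<le> 2" by simp
  have "b ^ d > 1" using b d by simp
  moreover have "b ^ d * e ^ d = 1" using co(4) by (simp flip: power_mult_distrib)
  ultimately have "b ^ d * (b ^ d + e ^ d - 2) = (b ^ d - 1) ^ 2" by (simp add: algebra_simps power2_eq_square)
  moreover have "(b ^ d - 1) ^ 2 > 0" using \<open>b ^ d > 1\<close> by simp
  ultimately have "0 < b ^ d * (b ^ d + e ^ d - 2)" by (simp only:)
  then have "b ^ d + e ^ d - 2 > 0" using \<open>b ^ d > 1\<close> zero_less_mult_pos by fastforce
  then show False using le by simp
qed

text \<open>
  In a factorisation of \<open>t ^ 4 + t ^ 3 + 1\<close> into real quadratics with constant terms \<open>b\<close> and \<open>1 / b\<close>,
  comparing coefficients determines the linear terms from \<open>b\<close> and leaves the single condition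
  \<open>(b ^ 2 + 1) * (b ^ 2 - 1) ^ 2 = b ^ 3\<close>. It has a solution with \<open>1 < b \<le> 3 / 2\<close>, and the upper bound
  makes both discriminants negative: the four roots are two conjugate pairs, of modulus \<open>sqrt b\<close> and
  \<open>1 / sqrt b\<close>.
\<close>
lemma not_eventually_periodic_1_4: "\<not> eventually_periodic (\<lambda>n. sgn (alt_composition_sum {1, 4} n))"
proof -
  define f where "f = alt_composition_sum {1, 4}"
  note rec = alt_composition_sum_1_4[folded f_def]
  have "\<exists>b\<ge>1. b \<le> 3 / 2 \<and> (b ^ 2 + 1) * (b ^ 2 - 1) ^ 2 - b ^ 3 = (0 :: real)"
    by (rule IVT) (auto intro!: continuous_intros simp: power2_eq_square power3_eq_cube)
  then obtain b :: real where b01: "1 \<le> b" "b \<le> 3 / 2"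
    and b: "(b ^ 2 + 1) * (b ^ 2 - 1) ^ 2 = b ^ 3" by auto
  have "b \<noteq> 1" using b by auto
  then have b1: "1 < b" using b01 by simp
  then have bb: "1 < b ^ 2" by simp
  have bb2: "b ^ 2 < 3" using power_mono[OF b01(2), of 2] b1 by (simp add: power2_eq_square)
  define c e a where "c = - 1 / (b ^ 2 - 1)" and "e = 1 / b" and "a = b ^ 2 / (b ^ 2 - 1)"
  have ac: "a = - (b ^ 2) * c" by (simp add: a_def c_def)
  have c2: "c ^ 2 = (b ^ 2 + 1) / b ^ 3"
  proof -
    have "b ^ 2 + 1 \<noteq> 0" "b ^ 2 - 1 \<noteq> 0" using bb by auto
    then show ?thesis by (simp add: c_def power_divide b[symmetric])
  qed
  have co: "a + c = 1" "b + e + a * c = 0" "a * e + b * c = 0" "b * e = 1"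
  proof -
    have "a + c = (b ^ 2 - 1) / (b ^ 2 - 1)" by (simp only: a_def c_def diff_divide_distrib)
    then show "a + c = 1" using bb by simp
    have "a * c = - (b ^ 2 * c ^ 2)" by (simp add: ac power2_eq_square)
    also have "b ^ 2 * c ^ 2 = b + e" unfolding c2 e_def
      using b1 by (simp add: field_simps power2_eq_square power3_eq_cube)
    finally show "b + e + a * c = 0" by simp
    show "a * e + b * c = 0" using b1 by (simp add: ac e_def power2_eq_square)
    show "b * e = 1" using b1 by (simp add: e_def)
  qed
  have e: "0 < e" "e < 1" using b1 by (auto simp: e_def)
  have "c < 0" using bb by (simp add: c_def)
  have "b ^ 2 + 1 < 4 * b ^ 2" using bb by simp
  then have "c ^ 2 < 4 * b ^ 2 / b ^ 3" unfolding c2 using b1 by (intro divide_strict_right_mono) auto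
  also have "\<dots> = 4 * e" using b1 by (simp add: e_def power2_eq_square power3_eq_cube)
  finally obtain y where y: "y + cnj y = - c" "y * cnj y = e" "Im y \<noteq> 0" "norm y = sqrt e"
      "y ^ 2 = of_real (- c) * y - of_real e"
    using nonreal_quadratic_root by blast
  have "a ^ 2 = b ^ 4 * c ^ 2" by (simp add: ac power_mult_distrib)
  also have "\<dots> = b * (b ^ 2 + 1)" unfolding c2
    using b1 by (simp add: power3_eq_cube power4_eq_xxxx)
  also have "\<dots> < 4 * b" using b1 bb2 by (simp add: field_simps)
  finally obtain z where z: "z + cnj z = - a" "z * cnj z = b" "Im z \<noteq> 0" "norm z = sqrt b"
      "z ^ 2 = of_real (- a) * z - of_real b"
    using nonreal_quadratic_root by blast
  \<comment> \<open>This combination of shifts removes the contributions of \<open>y\<close> and \<open>cnj y\<close>.\<close>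
  define v where "v n = f (n + 2) + c * f (n + 1) + e * f n" for n
  have v: "v (n + 2) = - a * v (n + 1) - b * v n" for n
  proof -
    have f4: "real_of_int (f (n + 4)) = - f (n + 3) - f n" using rec(4)[of n] by simp
    have "v (n + 2) + a * v (n + 1) + b * v n = f (n + 4) + (a + c) * f (n + 3)
        + (b + e + a * c) * f (n + 2) + (a * e + b * c) * f (n + 1) + (b * e) * f n"
      by (simp add: v_def algebra_simps numeral_eq_Suc)
    also have "\<dots> = 0" by (simp add: co f4)
    finally show ?thesis by simp
  qed
  obtain D where D: "\<And>n. v n = Re (D * z ^ n)"
    using second_order_recurrence_solution[OF v z(5)] z(3) by auto
  have "v 0 = 1 - c + e" using rec(1-3) by (simp add: v_def numeral_2_eq_2)
  then have "D \<noteq> 0" using D[of 0] e \<open>c < 0\<close> by auto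
  \<comment> \<open>On \<open>z ^ n\<close> the same combination acts as multiplication by \<open>s\<close>.\<close>
  define s where "s = z ^ 2 + c * z + e"
  have "Im s = (c - a) * Im z" by (simp add: s_def z(5) algebra_simps)
  moreover have "c < a" using bb \<open>c < 0\<close> by (simp add: a_def) (smt (verit) divide_pos_pos)
  ultimately have s0: "s \<noteq> 0" using z(3) by auto
  define C where "C = D / s"
  have "C \<noteq> 0" using s0 \<open>D \<noteq> 0\<close> by (simp add: C_def)
  define h where "h n = f n - Re (C * z ^ n)" for n
  have "h (n + 2) = - c * h (n + 1) - e * h n" for n
  proof -
    have "D * z ^ n = C * s * z ^ n" using s0 by (simp add: C_def)
    also have "\<dots> = C * z ^ (n + 2) + c * (C * z ^ (n + 1)) + e * (C * z ^ n)"
      by (simp add: s_def algebra_simps power2_eq_square)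
    finally have "v n = Re (C * z ^ (n + 2)) + c * Re (C * z ^ (n + 1)) + e * Re (C * z ^ n)"
      unfolding D by simp
    then show ?thesis by (simp add: h_def v_def algebra_simps)
  qed
  then obtain E where E: "\<And>n. h n = Re (E * y ^ n)"
    using second_order_recurrence_solution[OF _ y(5)] y(3) by blast
  have "\<not> eventually_periodic (\<lambda>n. sgn (f n))"
  proof (rule sgn_not_eventually_periodic)
    show "real_of_int (f n) = Re (C * z ^ n) + h n" for n by (simp add: h_def)
    show "\<bar>h n\<bar> \<le> norm E * sqrt e ^ n" for n
      using abs_Re_le_cmod[of "E * y ^ n"] by (simp add: E norm_mult norm_power y(4))
    show "0 \<le> sqrt e" "sqrt e < norm z" using e b1 z(4) by auto
    show "C \<noteq> 0" by fact
    show "z ^ d \<notin> \<real>" if "0 < d" for d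
      by (rule quartic_root_power_not_real[OF z(1,2) y(1,2) z(3) y(3) b1 co that])
  qed
  then show ?thesis by (simp add: f_def)
qed

theorem corollary3p10:
  fixes A :: "nat set"
  assumes "A = {2, 3} \<or> A = {1, 4}"
  shows "\<not> eventually_periodic (\<lambda>n. sgn (alt_composition_sum A n))"
  using assms not_eventually_periodic_2_3 not_eventually_periodic_1_4 by blast

end
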